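(* Let $(\boldsymbol\phi^*,\boldsymbol\psi^* )\in\mathcal A_C$ be a maximizer of $J_\epsilon$ over $\mathcal A_C$, and set, for $y\in Y$ and $i=1,\dots,p$, $$A_i^*(y):=\int_{X_i}\exp\left(\frac{\phi_i^*(x)-c_i(x,y)}{\epsilon}\right)d\nu_i(x).$$ Let $(\gamma_{1,\epsilon},\dots,\gamma_{p,\epsilon})$ be the unique optimal tuple of the primal problem and $\nu_\epsilon$ its common second marginal (the barycenter). Then for each $i=1,\dots,p$, $$\frac{d\gamma_{i,\epsilon}}{d\xi_i}(x,y)=\exp\left(\frac{\phi_i^*(x)+\psi_i^*(y)-c_i(x,y)}{\epsilon}\right)\qquad\xi_i\text{-a.e.}$$ The potentials therefore satisfy $$\int_Y\exp\left(\frac{\phi_i^*(x)+\psi_i^*(y)-c_i(x,y)}{\epsilon}\right)d\eta(y)=1\qquad\text{for }\nu_i\text{-a.e. }x,$$ and $$\psi_i^*(y)=\epsilon\left[\sum_{j=1}^p\lambda_j\log A_j^*(y)-\log A_i^*(y)\right].$$ The barycenter $\nu_\epsilon$ is absolutely continuous with respect to $\eta$, with density $$\frac{d\nu_\epsilon}{d\eta}(y)=\prod_{j=1}^pA_j^*(y)^{\lambda_j}.$$ This density is continuous and strictly positive on $Y$. Hence $\nu_\epsilon$ and $\eta$ are equivalent measures.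
   Context: Setting. Let $p\ge 2$ and $\epsilon>0$. Let $X_1,\dots,X_p$ and $Y$ be compact metric spaces; $\mathcal P(Z)$ denotes the Borel probability measures on $Z$ and $C(Z)$ the real-valued continuous functions on $Z$. For each $i$, let $\nu_i\in\mathcal P(X_i)$, $c_i\in C(X_i\times Y)$, and $\lambda_i>0$ with $\sum_{i=1}^p\lambda_i=1$. Fix $\eta\in\mathcal P(Y)$. Standing assumption: $\operatorname{spt}\nu_i=X_i$ for all $i$ and $\operatorname{spt}\eta=Y$. Set $\xi_i:=\nu_i\otimes\eta$ (product measure). Primal problem: minimize $\sum_{i=1}^p\lambda_i\left[\int_{X_i\times Y}c_i\,d\gamma_i+\epsilon\,\mathrm{KL}(\gamma_i\mid\xi_i)\right]$ over all $\nu\in\mathcal P(Y)$ and $\gamma_i\in\Pi(\nu_i,\nu)$, $i=1,\dots,p$, where $\Pi(\nu_i,\nu)$ is the set of Borel probability measures on $X_i\times Y$ with first marginal $\nu_i$ and second marginal $\nu$, and $\mathrm{KL}(\gamma\mid\xi):=\int\log\left(\frac{d\gamma}{d\xi}\right)d\gamma$ if $\gamma\ll\xi$ and $+\infty$ otherwise (with $0\log0=0$). This problem has a unique optimal tuple; its common second marginal is called the barycenter. $\mathcal A_C$ is the set of pairs $(\boldsymbol\phi,\boldsymbol\psi)$ with $\boldsymbol\phi=(\phi_1,\dots,\phi_p)$, $\boldsymbol\psi=(\psi_1,\dots,\psi_p)$, $\phi_i\in C(X_i)$, $\psi_i\in C(Y)$ and $\sum_{i=1}^p\lambda_i\psi_i=0$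 on $Y$. The dual functional is $$J_\epsilon(\boldsymbol\phi,\boldsymbol\psi):=\sum_{i=1}^p\lambda_i\left[\int_{X_i}\phi_i\,d\nu_i-\epsilon\int_{X_i\times Y}\exp\left(\frac{\phi_i(x)+\psi_i(y)-c_i(x,y)}{\epsilon}\right)d\xi_i(x,y)\right].$$ *)

theory Defs
  imports "HOL-Probability.Probability"
begin

text \<open>
  The spaces \<open>X\<^sub>1, \<dots>, X\<^sub>p\<close> are given as compact subsets \<open>X i\<close> (\<open>i \<in> {1..p}\<close>) of one metric space and
  \<open>Y\<close> as a compact subset of another; this loses no generality, since finitely many compact metric
  spaces embed isometrically into a common metric space. Functions on these spaces are represented
  by total functions of which only the values on \<open>X i\<close>, \<open>Y\<close> and \<open>X i \<times> Y\<close> matter.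
\<close>

definition borel_probs :: "'a::topological_space set \<Rightarrow> 'a measure set" where
  "borel_probs Z = {M. prob_space M \<and> sets M = sets (restrict_space borel Z)}"

definition spt :: "'a::topological_space measure \<Rightarrow> 'a set" where
  "spt M = {x \<in> space M. \<forall>U. open U \<and> x \<in> U \<longrightarrow> emeasure M (U \<inter> space M) > 0}"

definition couplings ::
  "'a::topological_space set \<Rightarrow> 'b::topological_space set \<Rightarrow> 'a measure \<Rightarrow> 'b measure \<Rightarrow> ('a \<times> 'b) measure set"
where
  "couplings A B \<mu> \<nu> = {\<gamma> \<in> borel_probs (A \<times> B). distr \<gamma> \<mu> fst = \<mu> \<and> distr \<gamma> \<nu> snd = \<nu>}"

text \<open>
  Extended-real-valued relative entropy of \<open>\<gamma>\<close> with respect to \<open>\<xi>\<close>. The library's \<open>KL_divergence\<close>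
  takes the reference measure first and is a Bochner integral, hence \<open>0\<close> when the integrand is not
  integrable. For probability measures with \<open>\<gamma>\<close> absolutely continuous with respect to \<open>\<xi>\<close>, the
  negative part of \<open>log (d\<gamma>/d\<xi>)\<close> is always \<open>\<gamma>\<close>-integrable, because \<open>t log t \<ge> - 1/e\<close>; so in the
  non-integrable case the integral is \<open>\<infinity>\<close>.
\<close>

definition KL :: "'a measure \<Rightarrow> 'a measure \<Rightarrow> ereal" where
  "KL \<gamma> \<xi> =
    (if absolutely_continuous \<xi> \<gamma> \<and> integrable \<gamma> (entropy_density (exp 1) \<xi> \<gamma>)
     then ereal (KL_divergence (exp 1) \<xi> \<gamma>) else \<infinity>)"

definition primal_feasible ::
  "nat \<Rightarrow> (nat \<Rightarrow> 'a::metric_space set) \<Rightarrow> 'b::metric_space set \<Rightarrow> (nat \<Rightarrow> 'a measure)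
    \<Rightarrow> (nat \<Rightarrow> ('a \<times> 'b) measure) \<Rightarrow> 'b measure \<Rightarrow> bool"
where
  "primal_feasible p X Y \<nu> \<gamma> \<nu>' \<longleftrightarrow>
    \<nu>' \<in> borel_probs Y \<and> (\<forall>i\<in>{1..p}. \<gamma> i \<in> couplings (X i) Y (\<nu> i) \<nu>')"

definition primal_cost ::
  "nat \<Rightarrow> real \<Rightarrow> (nat \<Rightarrow> real) \<Rightarrow> (nat \<Rightarrow> 'a \<times> 'b \<Rightarrow> real) \<Rightarrow> (nat \<Rightarrow> 'a measure) \<Rightarrow> 'b measure
    \<Rightarrow> (nat \<Rightarrow> ('a \<times> 'b) measure) \<Rightarrow> ereal"
where
  "primal_cost p eps lam c \<nu> \<eta> \<gamma> =
    (\<Sum>i=1..p. ereal (lam i) *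
      (ereal (\<integral>z. c i z \<partial>(\<gamma> i)) + ereal eps * KL (\<gamma> i) (\<nu> i \<Otimes>\<^sub>M \<eta>)))"

definition primal_optimal ::
  "nat \<Rightarrow> real \<Rightarrow> (nat \<Rightarrow> 'a::metric_space set) \<Rightarrow> 'b::metric_space set \<Rightarrow> (nat \<Rightarrow> real)
    \<Rightarrow> (nat \<Rightarrow> 'a \<times> 'b \<Rightarrow> real) \<Rightarrow> (nat \<Rightarrow> 'a measure) \<Rightarrow> 'b measure
    \<Rightarrow> (nat \<Rightarrow> ('a \<times> 'b) measure) \<Rightarrow> 'b measure \<Rightarrow> bool"
where
  "primal_optimal p eps X Y lam c \<nu> \<eta> \<gamma> \<nu>' \<longleftrightarrow>
    primal_feasible p X Y \<nu> \<gamma> \<nu>' \<and>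
    (\<forall>\<gamma>'' \<nu>''. primal_feasible p X Y \<nu> \<gamma>'' \<nu>'' \<longrightarrow>
      primal_cost p eps lam c \<nu> \<eta> \<gamma> \<le> primal_cost p eps lam c \<nu> \<eta> \<gamma>'')"

definition dual_admissible ::
  "nat \<Rightarrow> (nat \<Rightarrow> 'a::metric_space set) \<Rightarrow> 'b::metric_space set \<Rightarrow> (nat \<Rightarrow> real)
    \<Rightarrow> ((nat \<Rightarrow> 'a \<Rightarrow> real) \<times> (nat \<Rightarrow> 'b \<Rightarrow> real)) set"
where
  "dual_admissible p X Y lam =
    {(\<phi>, \<psi>). (\<forall>i\<in>{1..p}. continuous_on (X i) (\<phi> i) \<and> continuous_on Y (\<psi> i)) \<and>
      (\<forall>y\<in>Y. (\<Sum>i=1..p. lam i * \<psi> i y) = 0)}"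

definition dual_functional ::
  "nat \<Rightarrow> real \<Rightarrow> (nat \<Rightarrow> real) \<Rightarrow> (nat \<Rightarrow> 'a \<times> 'b \<Rightarrow> real) \<Rightarrow> (nat \<Rightarrow> 'a measure) \<Rightarrow> 'b measure
    \<Rightarrow> (nat \<Rightarrow> 'a \<Rightarrow> real) \<Rightarrow> (nat \<Rightarrow> 'b \<Rightarrow> real) \<Rightarrow> real"
where
  "dual_functional p eps lam c \<nu> \<eta> \<phi> \<psi> =
    (\<Sum>i=1..p. lam i *
      ((\<integral>x. \<phi> i x \<partial>(\<nu> i)) -
       eps * (\<integral>(x, y). exp ((\<phi> i x + \<psi> i y - c i (x, y)) / eps) \<partial>(\<nu> i \<Otimes>\<^sub>M \<eta>))))"

definition A_pot ::
  "real \<Rightarrow> (nat \<Rightarrow> 'a \<times> 'b \<Rightarrow> real) \<Rightarrow> (nat \<Rightarrow> 'a measure) \<Rightarrow> (nat \<Rightarrow> 'a \<Rightarrow> real) \<Rightarrow> nat \<Rightarrow> 'b \<Rightarrow> real"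
where
  "A_pot eps c \<nu> \<phi> i y = (\<integral>x. exp ((\<phi> i x - c i (x, y)) / eps) \<partial>(\<nu> i))"

end

theory Submission
  imports Defs
begin

text \<open>
  Two explicit competitors in the dual problem give the optimality conditions: replacing
  \<open>\<phi>\<^sub>i\<close> by \<open>\<phi>\<^sub>i - \<epsilon> ln G\<^sub>i\<close>, where \<open>G\<^sub>i\<close> is the density of the first marginal of the Gibbs plan
  \<open>exp ((\<phi>\<^sub>i + \<psi>\<^sub>i - c\<^sub>i)/\<epsilon>) \<xi>\<^sub>i\<close>, forces \<open>G\<^sub>i = 1\<close>, and replacing all \<open>\<psi>\<^sub>i\<close> at once by the claimed
  potentials forces equality in the weighted arithmetic-geometric mean inequality, first
  \<open>\<eta>\<close>-almost everywhere and, as \<open>\<eta>\<close> has full support, everywhere on \<open>Y\<close>. The Gibbs plans then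
  have the right first marginals and a common second marginal, and the Gibbs variational principle
  for the relative entropy shows that every optimal tuple coincides with them.
\<close>

text \<open>The equality case of \<open>1 + t \<le> exp t\<close>. It settles equality both in the
  Gibbs principle and in the weighted arithmetic-geometric mean inequality.\<close>

lemma exp_ge_add_one_self_eq_iff: "exp t - 1 - t = 0 \<longleftrightarrow> t = (0::real)"
proof
  assume "exp t - 1 - t = 0"
  then have "ln (exp t) = exp t - 1" by simp
  then have "exp t = 1" by (intro ln_eq_minus_one) auto
  then show "t = 0" by simp
qed simp

section \<open>Continuous functions and Borel probability measures on compact sets\<close>

lemma borel_probsD:
  assumes "M \<in> borel_probs Z"
  shows "prob_space M" "sets M = sets (restrict_space borel Z)" "space M = Z"
  using assms sets_eq_imp_space_eq[of M "restrict_space borel Z"]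
  by (auto simp: borel_probs_def space_restrict_space)

lemma borel_probs_measurable_continuous:
  assumes "M \<in> borel_probs Z" "continuous_on Z f"
  shows "f \<in> borel_measurable M"
  using borel_measurable_continuous_on_restrict[OF assms(2)]
    measurable_cong_sets[OF borel_probsD(2)[OF assms(1)] refl] by blast

lemma borel_probs_integrable_continuous:
  fixes f :: "_ \<Rightarrow> real"
  assumes "M \<in> borel_probs Z" "compact Z" "continuous_on Z f"
  shows "integrable M f"
proof -
  interpret prob_space M using borel_probsD(1)[OF assms(1)] .
  have "bounded (f ` Z)"
    using compact_imp_bounded[OF compact_continuous_image[OF assms(3,2)]] .
  then obtain B where "\<forall>x\<in>Z. norm (f x) \<le> B" by (auto simp: bounded_iff)
  then show ?thesis
    using borel_probs_measurable_continuous[OF assms(1,3)] borel_probsD(3)[OF assms(1)]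
    by (intro integrable_const_bound[of _ B]) auto
qed

text \<open>If \<open>f\<close> were positive somewhere, it would be positive on a nonempty
  relatively open set, which has positive mass because the support is full; yet the vanishing
  integral makes \<open>f\<close> zero almost everywhere. This turns almost-everywhere information
  into an identity at each point.\<close>

lemma integral_eq_0_full_spt:
  fixes f :: "_ \<Rightarrow> real"
  assumes M: "M \<in> borel_probs Z" and "spt M = Z" and "compact Z" and f: "continuous_on Z f"
    and nonneg: "\<And>x. x \<in> Z \<Longrightarrow> 0 \<le> f x" and "integral\<^sup>L M f \<le> 0" and "x \<in> Z"
  shows "f x = 0"
proof (rule ccontr)
  assume "f x \<noteq> 0"
  then have "f x > 0" using nonneg[OF \<open>x \<in> Z\<close>] by simp
  obtain U where U: "open U" "U \<inter> Z = f -` {0<..} \<inter> Z"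
    using continuous_on_open_invariant[THEN iffD1, OF f, rule_format, of "{0<..}"] by auto
  have sp: "space M = Z" using borel_probsD(3)[OF M] .
  have pos: "emeasure M (U \<inter> Z) > 0"
    using assms(2) \<open>x \<in> Z\<close> \<open>f x > 0\<close> U unfolding spt_def sp by blast
  have int: "integrable M f" using borel_probs_integrable_continuous[OF M assms(3) f] .
  have nn: "AE x in M. 0 \<le> f x" using nonneg sp by (intro AE_I2) blast
  have "integral\<^sup>L M f = 0" using assms(6) integral_nonneg_AE[OF nn] by linarith
  then have "AE x in M. f x = 0" unfolding integral_nonneg_eq_0_iff_AE[OF int nn] .
  then have ae: "AE x in M. x \<notin> U \<inter> Z" by (rule AE_mp) (use U sp in \<open>intro AE_I2, auto\<close>)
  have m: "U \<inter> Z \<in> sets M"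
    using U(1) unfolding borel_probsD(2)[OF M] by (auto simp: sets_restrict_space)
  have eq: "{x \<in> space M. \<not> x \<notin> U \<inter> Z} = U \<inter> Z" using sp by auto
  have "emeasure M (U \<inter> Z) = 0" using AE_iff_measurable[OF m eq] ae by (rule iffD1)
  with pos show False by simp
qed

lemma continuous_on_integral_param:
  fixes f :: "'a::metric_space \<Rightarrow> 'b::metric_space \<Rightarrow> real"
  assumes M: "M \<in> borel_probs A" and A: "compact A" and B: "compact B"
    and f: "continuous_on (A \<times> B) (\<lambda>(x, y). f x y)"
  shows "continuous_on B (\<lambda>y. \<integral>x. f x y \<partial>M)"
  unfolding continuous_on_iff
proof (intro ballI allI impI)
  fix y and e :: real assume "0 < e" and y: "y \<in> B"
  interpret prob_space M using borel_probsD(1)[OF M] .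
  have sp: "space M = A" using borel_probsD(3)[OF M] .
  have "uniformly_continuous_on (A \<times> B) (\<lambda>(x, y). f x y)"
    using compact_uniformly_continuous[OF f compact_Times[OF A B]] .
  \<comment> \<open>Uniform continuity makes \<open>d\<close> independent of the integration
    variable. The bound \<open>e / 2\<close> keeps the final inequality strict, since monotonicity
    of the integral gives only \<le>.\<close>
  then obtain d where d: "d > 0"
    "\<And>u v. u \<in> A \<times> B \<Longrightarrow> v \<in> A \<times> B \<Longrightarrow> dist v u < d
       \<Longrightarrow> dist ((\<lambda>(x, y). f x y) v) ((\<lambda>(x, y). f x y) u) < e / 2"
    using \<open>0 < e\<close> unfolding uniformly_continuous_on_def by (metis half_gt_zero)
  have int: "integrable M (\<lambda>x. f x y)" if "y \<in> B" for y
  proof (rule borel_probs_integrable_continuous[OF M A])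
    show "continuous_on A (\<lambda>x. f x y)"
      using continuous_on_compose2[OF f, of A "\<lambda>x. (x, y)"] that
      by (simp add: continuous_on_Pair image_subset_iff)
  qed
  have "dist (\<integral>x. f x y' \<partial>M) (\<integral>x. f x y \<partial>M) < e" if y': "y' \<in> B" "dist y' y < d" for y'
  proof -
    have "norm (f x y' - f x y) \<le> e / 2" if "x \<in> A" for x
      using d(2)[of "(x, y)" "(x, y')"] that y y' by (simp add: dist_Pair_Pair dist_real_def)
    then have "(\<integral>x. norm (f x y' - f x y) \<partial>M) \<le> (\<integral>x. e / 2 \<partial>M)"
      using int[OF y] int[OF y'(1)] sp by (intro integral_mono) auto
    then have "norm (\<integral>x. f x y' - f x y \<partial>M) \<le> (\<integral>x. e / 2 \<partial>M)"
      by (rule order_trans[OF integral_norm_bound])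
    then show ?thesis
      using int[OF y] int[OF y'(1)] \<open>0 < e\<close> by (simp add: dist_real_def prob_space)
  qed
  with d(1) show "\<exists>d>0. \<forall>y'\<in>B. dist y' y < d \<longrightarrow> dist (\<integral>x. f x y' \<partial>M) (\<integral>x. f x y \<partial>M) < e"
    by blast
qed

section \<open>The product sigma-algebra of two compact metric spaces\<close>

lemma compact_countable_net:
  fixes A :: "'a::metric_space set"
  assumes "compact A"
  obtains D where "countable D" "\<And>x e. x \<in> A \<Longrightarrow> e > 0 \<Longrightarrow> \<exists>a\<in>D. dist a x < e"
proof -
  have "\<exists>k. finite k \<and> A \<subseteq> (\<Union>a\<in>k. ball a (1 / real (Suc n)))" for n
    using compactE_image[OF assms, of A "\<lambda>a. ball a (1 / real (Suc n))"]
    by (metis (no_types, lifting) UN_I centre_in_ball of_nat_0_less_iff open_ball subsetI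
        zero_less_Suc zero_less_divide_1_iff)
  then obtain k where k: "\<And>n. finite (k n)" "\<And>n. A \<subseteq> (\<Union>a\<in>k n. ball a (1 / real (Suc n)))"
    by metis
  show ?thesis
  proof (rule that[of "\<Union>n. k n"])
    show "countable (\<Union>n. k n)" using k(1) by (auto intro: countable_finite)
    fix x and e :: real assume "x \<in> A" "e > 0"
    obtain n where "1 / real (Suc n) < e" using nat_approx_posE[OF \<open>e > 0\<close>] by blast
    moreover obtain a where "a \<in> k n" "dist a x < 1 / real (Suc n)"
      using k(2)[of n] \<open>x \<in> A\<close> by auto
    ultimately show "\<exists>a\<in>\<Union>n. k n. dist a x < e" by (meson UN_I UNIV_I less_trans)
  qed
qed

text \<open>
  The ambient metric spaces need not be second countable, so compactness is what makes every
  relatively open subset of the product a countable union of open rectangles.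
\<close>

lemma sets_pair_restrict_borel_compact:
  fixes A :: "'a::metric_space set" and B :: "'b::metric_space set"
  assumes A: "compact A" and B: "compact B"
  shows "sets (restrict_space borel A \<Otimes>\<^sub>M restrict_space borel B)
    = sets (restrict_space borel (A \<times> B))" (is "sets ?P = sets ?R")
proof
  show "sets ?P \<subseteq> sets ?R"
  proof (rule sets_pair_in_sets)
    fix a b assume "a \<in> sets (restrict_space borel A)" "b \<in> sets (restrict_space borel B)"
    then obtain S T where S: "S \<in> sets borel" "a = A \<inter> S" and T: "T \<in> sets borel" "b = B \<inter> T"
      by (auto simp: sets_restrict_space)
    have "fst -` S \<in> sets (borel :: ('a \<times> 'b) measure)" "snd -` T \<in> sets (borel :: ('a \<times> 'b) measure)"
      using measurable_sets_borel[OF borel_measurable_continuous_onI S(1), of fst]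
        measurable_sets_borel[OF borel_measurable_continuous_onI T(1), of snd]
      by (simp_all add: continuous_on_fst continuous_on_snd)
    moreover have "a \<times> b = (A \<times> B) \<inter> (fst -` S \<inter> snd -` T)" using S T by auto
    ultimately show "a \<times> b \<in> sets ?R" by (auto simp: sets_restrict_space)
  qed
next
  obtain D where D: "countable D" "\<And>x e. x \<in> A \<Longrightarrow> e > 0 \<Longrightarrow> \<exists>a\<in>D. dist a x < e"
    using compact_countable_net[OF A] by metis
  obtain E where E: "countable E" "\<And>x e. x \<in> B \<Longrightarrow> e > 0 \<Longrightarrow> \<exists>a\<in>E. dist a x < e"
    using compact_countable_net[OF B] by metis
  \<comment> \<open>Preimages under \<open>id\<close> are traces on \<open>A \<times> B\<close>, so
    its measurability says that traces of Borel sets lie in the product sigma-algebra; open sets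
    suffice to check this.\<close>
  have "id \<in> measurable ?P (borel :: ('a \<times> 'b) measure)"
  proof (rule borel_measurableI)
    fix W :: "('a \<times> 'b) set" assume W: "open W"
    \<comment> \<open>Countably many candidates: products of balls around net points, cut down to
      \<open>A\<close> and \<open>B\<close>. The index set \<open>I\<close> keeps those inside
      \<open>W\<close>.\<close>
    define rect where "rect = (\<lambda>(a, b, n). (ball a (1 / real (Suc n)) \<inter> A) \<times> (ball b (1 / real (Suc n)) \<inter> B))"
    define I where "I = {j \<in> D \<times> E \<times> UNIV. rect j \<subseteq> W}"
    have 1: "W \<inter> (A \<times> B) \<subseteq> (\<Union>j\<in>I. rect j)"
    proof
      fix z assume z: "z \<in> W \<inter> (A \<times> B)"
      obtain x y where xy: "z = (x, y)" by (cases z)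
      obtain e where e: "e > 0" "ball z e \<subseteq> W" using W z open_contains_ball by blast
      \<comment> \<open>In each coordinate, a point of the rectangle is within two radii of
        \<open>z\<close>, and the product distance is at most the sum over both coordinates: four
        radii have to fit into \<open>e\<close>.\<close>
      obtain n where n: "1 / real (Suc n) < e / 4" using nat_approx_posE[of "e / 4"] e by auto
      obtain a where a: "a \<in> D" "dist a x < 1 / real (Suc n)"
        using D(2)[of x "1 / real (Suc n)"] z xy by auto
      obtain b where b: "b \<in> E" "dist b y < 1 / real (Suc n)"
        using E(2)[of y "1 / real (Suc n)"] z xy by auto
      have "rect (a, b, n) \<subseteq> ball z e"
      proof
        fix w assume "w \<in> rect (a, b, n)"
        then obtain u v where w: "w = (u, v)" "dist a u < 1 / real (Suc n)" "dist b v < 1 / real (Suc n)"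
          by (auto simp: rect_def)
        have "dist z w \<le> dist x u + dist y v"
          unfolding xy w dist_Pair_Pair by (rule sqrt_sum_squares_le_sum) auto
        moreover have "dist x u \<le> dist a x + dist a u" "dist y v \<le> dist b y + dist b v"
          using dist_triangle2 dist_triangle by (metis dist_commute)+
        ultimately show "w \<in> ball z e" using n a b w by simp
      qed
      then have "(a, b, n) \<in> I" using e a b by (auto simp: I_def)
      moreover have "z \<in> rect (a, b, n)" using a b z xy by (auto simp: rect_def)
      ultimately show "z \<in> (\<Union>j\<in>I. rect j)" by blast
    qed
    have 2: "(\<Union>j\<in>I. rect j) \<subseteq> A \<times> B" by (auto simp: rect_def)
    have 3: "(\<Union>j\<in>I. rect j) \<subseteq> W" by (auto simp: I_def)
    have W_eq: "W \<inter> (A \<times> B) = (\<Union>j\<in>I. rect j)" using equalityI[OF 1 Int_greatest[OF 3 2]] .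
    have "countable (D \<times> E \<times> (UNIV :: nat set))" using D(1) E(1) by simp
    then have I: "countable I" by (rule countable_subset[rotated]) (auto simp: I_def)
    have "rect j \<in> sets ?P" for j
      unfolding rect_def
      by (cases j) (auto simp: sets_restrict_space Int_commute intro!: pair_measureI imageI)
    then have "W \<inter> (A \<times> B) \<in> sets ?P" unfolding W_eq using I by (intro sets.countable_UN') auto
    then show "id -` W \<inter> space ?P \<in> sets ?P"
      by (simp add: space_pair_measure space_restrict_space)
  qed
  then have "S \<inter> (A \<times> B) \<in> sets ?P" if "S \<in> sets borel" for S
    using measurable_sets[OF _ that, of id ?P] by (simp add: space_pair_measure space_restrict_space)
  then show "sets ?R \<subseteq> sets ?P" by (auto simp: sets_restrict_space Int_commute)
qed

lemma pair_measure_borel_probs: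
  fixes A :: "'a::metric_space set" and B :: "'b::metric_space set"
  assumes M: "M \<in> borel_probs A" and N: "N \<in> borel_probs B" and "compact A" "compact B"
  shows "M \<Otimes>\<^sub>M N \<in> borel_probs (A \<times> B)"
proof -
  interpret M: prob_space M using borel_probsD(1)[OF M] .
  interpret N: prob_space N using borel_probsD(1)[OF N] .
  interpret MN: pair_prob_space M N ..
  have "sets (M \<Otimes>\<^sub>M N) = sets (restrict_space borel A \<Otimes>\<^sub>M restrict_space borel B)"
    using borel_probsD(2)[OF M] borel_probsD(2)[OF N] by (rule sets_pair_measure_cong)
  then show ?thesis
    using sets_pair_restrict_borel_compact[OF assms(3,4)] MN.prob_space_axioms
    by (simp add: borel_probs_def)
qed

section \<open>Relative entropy and the Gibbs variational principle\<close>

lemma KL_density_exp: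
  assumes "prob_space M" and g[measurable]: "g \<in> borel_measurable M"
    and N: "N = density M (\<lambda>x. ennreal (exp (g x)))" and "integrable N g"
  shows "KL N M = ereal (integral\<^sup>L N g)"
proof -
  interpret M: prob_space M by fact
  have sN: "sets N = sets M" by (simp add: N)
  \<comment> \<open>The Radon-Nikodym derivative is \<open>exp g\<close>, so the entropy density is
    \<open>g\<close> itself, and the integrability of \<open>g\<close> selects the finite branch of
    \<open>KL\<close>.\<close>
  have "AE x in M. ennreal (exp (g x)) = RN_deriv M N x"
    by (rule M.RN_deriv_unique) (auto simp: N)
  then have "AE x in N. entropy_density (exp 1) M N x = g x"
    unfolding N by (subst AE_density)
      (auto simp: entropy_density_def log_ln[symmetric] elim!: AE_mp dest!: sym[of "ennreal _"])
  moreover have "entropy_density (exp 1) M N \<in> borel_measurable N"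
    unfolding measurable_cong_sets[OF sN refl] by simp
  moreover have "g \<in> borel_measurable N" by (simp add: N)
  ultimately have "integrable N (entropy_density (exp 1) M N)"
    "integral\<^sup>L N (entropy_density (exp 1) M N) = integral\<^sup>L N g"
    using assms(4) integrable_cong_AE integral_cong_AE by blast+
  moreover have "absolutely_continuous M N" unfolding N by (rule absolutely_continuousI_density) simp
  ultimately show ?thesis by (simp add: KL_def KL_divergence_def)
qed

text \<open>
  Gibbs variational principle: \<open>KL N M - \<integral> g dN\<close> is the integral over \<open>M\<close> of
  \<open>D ln D - D g - D + e\<^sup>g\<close>, where \<open>D = dN/dM\<close>. For \<open>D > 0\<close> the integrand is
  \<open>D (e\<^sup>t - 1 - t)\<close> with \<open>t = g - ln D\<close>.
\<close>

lemma KL_variational: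
  assumes "prob_space M" and "prob_space N" and sN: "sets N = sets M"
    and g: "g \<in> borel_measurable M" "integrable N g"
    and eg: "integrable M (\<lambda>x. exp (g x))" "(\<integral>x. exp (g x) \<partial>M) = 1"
  shows "ereal (integral\<^sup>L N g) \<le> KL N M"
    and "KL N M \<le> ereal (integral\<^sup>L N g) \<Longrightarrow> N = density M (\<lambda>x. ennreal (exp (g x)))"
proof -
  interpret M: prob_space M by fact
  interpret N: prob_space N by fact
  note [measurable] = g(1)
  have *: "ereal (integral\<^sup>L N g) \<le> KL N M \<and>
    (KL N M \<le> ereal (integral\<^sup>L N g) \<longrightarrow> N = density M (\<lambda>x. ennreal (exp (g x))))"
  proof (cases "absolutely_continuous M N \<and> integrable N (entropy_density (exp 1) M N)")
    case True
    then have ac: "absolutely_continuous M N" and int: "integrable N (entropy_density (exp 1) M N)"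
      by auto
    \<comment> \<open>A real version of the derivative that is nonnegative at every point, so that
      the inequalities below hold pointwise.\<close>
    obtain D where D[measurable]: "D \<in> borel_measurable M"
      and D2: "AE x in M. RN_deriv M N x = ennreal (D x)"
      and D0: "\<And>x. 0 \<le> D x"
      using M.real_RN_deriv[OF N.finite_measure_axioms ac sN] by metis
    have "N = density M (RN_deriv M N)" using M.density_RN_deriv[OF ac sN] by simp
    also have "\<dots> = density M D" using D2 by (intro density_cong) auto
    finally have N: "N = density M D" .
    have "AE x in N. entropy_density (exp 1) M N x = ln (D x)"
      using absolutely_continuous_AE[OF sN ac D2] D0
      by (auto simp: entropy_density_def log_ln[symmetric] elim!: AE_mp)
    moreover have m: "entropy_density (exp 1) M N \<in> borel_measurable N"
      unfolding measurable_cong_sets[OF sN refl] by simp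
    moreover have lnD: "(\<lambda>x. ln (D x)) \<in> borel_measurable N"
      unfolding measurable_cong_sets[OF sN refl] by simp
    ultimately have i1: "integrable N (\<lambda>x. ln (D x))"
      and e: "integral\<^sup>L N (entropy_density (exp 1) M N) = (\<integral>x. ln (D x) \<partial>N)"
      using integrable_cong_AE[OF m lnD] integral_cong_AE[OF m lnD] int by blast+
    have KL: "KL N M = ereal (\<integral>x. ln (D x) \<partial>N)"
      using True e by (simp add: KL_def KL_divergence_def)
    have i3: "integrable N (\<lambda>x. ln (D x) - g x - 1)" using i1 g(2) by auto
    define h where "h = (\<lambda>x. D x * (ln (D x) - g x - 1))"
    have ih: "integrable M h"
      using i3 unfolding h_def N by (subst (asm) integrable_real_density) (auto simp: D0)
    have "integral\<^sup>L M h = (\<integral>x. ln (D x) - g x - 1 \<partial>N)"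
      unfolding h_def N by (subst integral_real_density) (simp_all add: D0)
    also have "\<dots> = (\<integral>x. ln (D x) \<partial>N) - integral\<^sup>L N g - 1"
      using i1 g(2) by (simp add: N.prob_space)
    \<comment> \<open>The \<open>- 1\<close> left by the unit mass of \<open>N\<close> cancels
      against the integral of \<open>exp g\<close>, which is 1 by assumption.\<close>
    finally have I: "(\<integral>x. h x + exp (g x) \<partial>M) = (\<integral>x. ln (D x) \<partial>N) - integral\<^sup>L N g"
      using ih eg by simp
    have pos: "h x + exp (g x) = D x * (exp (g x - ln (D x)) - 1 - (g x - ln (D x)))"
      if "D x > 0" for x using that by (simp add: h_def exp_diff field_simps)
    have nn: "0 \<le> h x + exp (g x)" for x
    proof (cases "D x = 0")
      case True then show ?thesis by (simp add: h_def)
    next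
      case False
      with D0[of x] have "D x > 0" by simp
      moreover have "0 \<le> exp (g x - ln (D x)) - 1 - (g x - ln (D x))"
        using exp_ge_add_one_self[of "g x - ln (D x)"] by linarith
      ultimately show ?thesis unfolding pos[OF \<open>D x > 0\<close>] by simp
    qed
    \<comment> \<open>Where \<open>D x = 0\<close> the sum is \<open>exp (g x) > 0\<close>, so that
      case is contradictory; elsewhere this is the equality case of the exponential
      inequality.\<close>
    have z: "D x = exp (g x)" if "h x + exp (g x) = 0" for x
    proof (cases "D x = 0")
      case True then show ?thesis using that by (simp add: h_def)
    next
      case False
      with D0[of x] have p: "D x > 0" by simp
      with that pos[OF p] have "exp (g x - ln (D x)) - 1 - (g x - ln (D x)) = 0" by simp
      then have "g x = ln (D x)" using exp_ge_add_one_self_eq_iff by force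
      then show ?thesis using p by simp
    qed
    have "0 \<le> (\<integral>x. h x + exp (g x) \<partial>M)" using nn by simp
    moreover have "N = density M (\<lambda>x. ennreal (exp (g x)))" if "(\<integral>x. h x + exp (g x) \<partial>M) \<le> 0"
    proof -
      have "(\<integral>x. h x + exp (g x) \<partial>M) = 0" using that calculation by simp
      then have "AE x in M. h x + exp (g x) = 0"
        using integral_nonneg_eq_0_iff_AE[of M "\<lambda>x. h x + exp (g x)"] ih eg(1) nn by simp
      then have "AE x in M. ennreal (D x) = ennreal (exp (g x))"
        by (rule AE_mp) (use z in auto)
      then show ?thesis using N by (auto intro!: density_cong)
    qed
    ultimately show ?thesis unfolding KL I by auto
  \<comment> \<open>In the remaining case the entropy is infinite: the lower bound is trivial and
    the premise of the equality claim fails.\<close>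
  qed (auto simp: KL_def)
  show "ereal (integral\<^sup>L N g) \<le> KL N M" using * by (rule conjunct1)
  show "KL N M \<le> ereal (integral\<^sup>L N g) \<Longrightarrow> N = density M (\<lambda>x. ennreal (exp (g x)))"
    using * by (rule conjunct2[THEN mp])
qed

subsection \<open>Marginals of Gibbs densities\<close>

text \<open>Tonelli: the indicator of the cylinder over \<open>S\<close> depends on \<open>x\<close>
  only and leaves the inner integral.\<close>

lemma distr_density_pair_fst:
  assumes "sigma_finite_measure M" "sigma_finite_measure N"
    and f[measurable]: "f \<in> borel_measurable (M \<Otimes>\<^sub>M N)"
  shows "distr (density (M \<Otimes>\<^sub>M N) f) M fst = density M (\<lambda>x. \<integral>\<^sup>+y. f (x, y) \<partial>N)"
proof (rule measure_eqI)
  interpret N: sigma_finite_measure N by fact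
  fix S assume "S \<in> sets (distr (density (M \<Otimes>\<^sub>M N) f) M fst)"
  then have S[measurable]: "S \<in> sets M" by simp
  have "emeasure (distr (density (M \<Otimes>\<^sub>M N) f) M fst) S
    = (\<integral>\<^sup>+z. f z * indicator (fst -` S \<inter> space (M \<Otimes>\<^sub>M N)) z \<partial>(M \<Otimes>\<^sub>M N))"
    by (simp add: emeasure_distr emeasure_density)
  also have "\<dots> = (\<integral>\<^sup>+z. f z * indicator S (fst z) \<partial>(M \<Otimes>\<^sub>M N))"
    by (intro nn_integral_cong) (auto simp: indicator_def)
  also have "\<dots> = (\<integral>\<^sup>+x. \<integral>\<^sup>+y. f (x, y) * indicator S x \<partial>N \<partial>M)"
    by (subst N.nn_integral_fst[symmetric]) auto
  also have "\<dots> = emeasure (density M (\<lambda>x. \<integral>\<^sup>+y. f (x, y) \<partial>N)) S"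
    by (subst emeasure_density) (auto intro!: nn_integral_cong nn_integral_multc)
  finally show "emeasure (distr (density (M \<Otimes>\<^sub>M N) f) M fst) S
    = emeasure (density M (\<lambda>x. \<integral>\<^sup>+y. f (x, y) \<partial>N)) S" .
qed simp

lemma distr_density_pair_snd:
  assumes "sigma_finite_measure M" "sigma_finite_measure N"
    and f[measurable]: "f \<in> borel_measurable (M \<Otimes>\<^sub>M N)"
  shows "distr (density (M \<Otimes>\<^sub>M N) f) N snd = density N (\<lambda>y. \<integral>\<^sup>+x. f (x, y) \<partial>M)"
proof (rule measure_eqI)
  interpret M: sigma_finite_measure M by fact
  interpret N: sigma_finite_measure N by fact
  interpret pair_sigma_finite M N ..
  fix S assume "S \<in> sets (distr (density (M \<Otimes>\<^sub>M N) f) N snd)"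
  then have S[measurable]: "S \<in> sets N" by simp
  have "emeasure (distr (density (M \<Otimes>\<^sub>M N) f) N snd) S
    = (\<integral>\<^sup>+z. f z * indicator (snd -` S \<inter> space (M \<Otimes>\<^sub>M N)) z \<partial>(M \<Otimes>\<^sub>M N))"
    by (simp add: emeasure_distr emeasure_density)
  also have "\<dots> = (\<integral>\<^sup>+z. f z * indicator S (snd z) \<partial>(M \<Otimes>\<^sub>M N))"
    by (intro nn_integral_cong) (auto simp: indicator_def)
  also have "\<dots> = (\<integral>\<^sup>+y. \<integral>\<^sup>+x. f (x, y) * indicator S y \<partial>M \<partial>N)"
    by (subst nn_integral_snd[symmetric]) (auto simp: split_beta')
  also have "\<dots> = emeasure (density N (\<lambda>y. \<integral>\<^sup>+x. f (x, y) \<partial>M)) S"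
    by (subst emeasure_density) (auto intro!: nn_integral_cong nn_integral_multc)
  finally show "emeasure (distr (density (M \<Otimes>\<^sub>M N) f) N snd) S
    = emeasure (density N (\<lambda>y. \<integral>\<^sup>+x. f (x, y) \<partial>M)) S" .
qed simp

text \<open>The excesses \<open>b j - a j\<close> are nonnegative with sum at most zero, so all
  vanish. An infinite \<open>b j\<close> would make the whole sum infinite; excluding this first
  allows the differences to be taken in the reals. The lemma extracts equality at each index from a
  bound on the total cost.\<close>

lemma sum_ereal_le_imp_eq:
  assumes "finite I" and "\<And>i. i \<in> I \<Longrightarrow> ereal (a i) \<le> b i"
    and "sum b I \<le> ereal (sum a I)" and "i \<in> I"
  shows "b i = ereal (a i)"
proof -
  have fin: "\<bar>b j\<bar> \<noteq> \<infinity>" if j: "j \<in> I" for j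
  proof
    assume "\<bar>b j\<bar> = \<infinity>"
    then have "b j = \<infinity>" using assms(2)[OF j] by (cases "b j") auto
    then have "sum b I = \<infinity>" using assms(1,2) j by (auto simp: sum_Pinfty)
    then show False using assms(3) by simp
  qed
  define r where "r = (\<lambda>j. real_of_ereal (b j))"
  have b: "b j = ereal (r j)" if "j \<in> I" for j using fin[OF that] by (simp add: r_def ereal_real')
  have "sum b I = ereal (sum r I)" using b by simp
  then have "sum r I \<le> sum a I" using assms(3) by simp
  moreover have le: "a j \<le> r j" if "j \<in> I" for j using assms(2)[OF that] b[OF that] by simp
  ultimately have "(\<Sum>j\<in>I. r j - a j) = 0"
    using sum_nonneg[of I "\<lambda>j. r j - a j"] by (simp add: sum_subtractf)
  then have "r i - a i = 0"
    using sum_nonneg_eq_0_iff[of I "\<lambda>j. r j - a j"] assms(1,4) le by simp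
  then show ?thesis using b[OF assms(4)] by simp
qed

lemma prob_integral_exp_pos:
  fixes h :: "'a \<Rightarrow> real"
  assumes "prob_space M" "integrable M (\<lambda>x. exp (h x))"
  shows "(\<integral>x. exp (h x) \<partial>M) > 0"
proof -
  interpret prob_space M by fact
  show ?thesis
    using integral_less_AE_space[of "\<lambda>_. 0" "\<lambda>x. exp (h x)"] assms(2) emeasure_space_1 by simp
qed

section \<open>Gibbs kernels and their marginals for arbitrary continuous potentials\<close>

locale entropic_barycenter =
  fixes p :: nat and eps :: real
    and X :: "nat \<Rightarrow> 'a::metric_space set" and Y :: "'b::metric_space set"
    and \<nu> :: "nat \<Rightarrow> 'a measure" and \<eta> :: "'b measure"
    and c :: "nat \<Rightarrow> 'a \<times> 'b \<Rightarrow> real" and lam :: "nat \<Rightarrow> real"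
  assumes eps: "eps > 0"
    and X: "\<And>i. i \<in> {1..p} \<Longrightarrow> compact (X i)" and Y: "compact Y"
    and \<nu>: "\<And>i. i \<in> {1..p} \<Longrightarrow> \<nu> i \<in> borel_probs (X i)" and \<eta>: "\<eta> \<in> borel_probs Y"
    and c: "\<And>i. i \<in> {1..p} \<Longrightarrow> continuous_on (X i \<times> Y) (c i)"
    and lam: "\<And>i. i \<in> {1..p} \<Longrightarrow> lam i > 0" and sum_lam: "(\<Sum>i=1..p. lam i) = 1"
begin

sublocale \<eta>: prob_space \<eta> using borel_probsD(1)[OF \<eta>] .

text \<open>The logarithm of the Gibbs density. The potentials are arguments, so that the facts
  below serve the dual competitors as well as the maximizer.\<close>

definition logG :: "nat \<Rightarrow> ('a \<Rightarrow> real) \<Rightarrow> ('b \<Rightarrow> real) \<Rightarrow> 'a \<times> 'b \<Rightarrow> real" where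
  "logG i f g = (\<lambda>(x, y). (f x + g y - c i (x, y)) / eps)"

context
  fixes i assumes i: "i \<in> {1..p}"
begin

lemma pair_prob: "pair_prob_space (\<nu> i) \<eta>"
proof -
  interpret N: prob_space "\<nu> i" using borel_probsD(1)[OF \<nu>[OF i]] .
  show ?thesis ..
qed

lemma \<xi>_borel_probs: "\<nu> i \<Otimes>\<^sub>M \<eta> \<in> borel_probs (X i \<times> Y)"
  using pair_measure_borel_probs[OF \<nu>[OF i] \<eta> X[OF i] Y] .

lemma continuous_logG:
  assumes "continuous_on (X i) f" "continuous_on Y g"
  shows "continuous_on (X i \<times> Y) (logG i f g)"
proof -
  have "continuous_on (X i \<times> Y) (\<lambda>z. f (fst z))"
    by (rule continuous_on_compose2[OF assms(1)]) (auto intro!: continuous_intros)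
  moreover have "continuous_on (X i \<times> Y) (\<lambda>z. g (snd z))"
    by (rule continuous_on_compose2[OF assms(2)]) (auto intro!: continuous_intros)
  ultimately show ?thesis
    unfolding logG_def split_beta' using c[OF i] eps by (auto intro!: continuous_intros)
qed

lemma continuous_exp_logG:
  assumes "continuous_on (X i) f" "continuous_on Y g"
  shows "continuous_on (X i \<times> Y) (\<lambda>z. exp (logG i f g z))"
  using continuous_logG[OF assms] by (rule continuous_on_exp)

lemma integrable_exp_logG:
  assumes "continuous_on (X i) f" "continuous_on Y g"
  shows "integrable (\<nu> i \<Otimes>\<^sub>M \<eta>) (\<lambda>z. exp (logG i f g z))"
  using borel_probs_integrable_continuous[OF \<xi>_borel_probs compact_Times[OF X[OF i] Y]
      continuous_exp_logG[OF assms]] .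

lemma integrable_exp_logG_slice:
  assumes "continuous_on (X i) f" "continuous_on Y g"
  shows "x \<in> X i \<Longrightarrow> integrable \<eta> (\<lambda>y. exp (logG i f g (x, y)))"
    and "y \<in> Y \<Longrightarrow> integrable (\<nu> i) (\<lambda>x. exp (logG i f g (x, y)))"
proof -
  assume "x \<in> X i"
  then have "continuous_on Y (\<lambda>y. exp (logG i f g (x, y)))"
    by (intro continuous_on_compose2[OF continuous_exp_logG[OF assms]]) (auto intro!: continuous_intros)
  then show "integrable \<eta> (\<lambda>y. exp (logG i f g (x, y)))"
    by (rule borel_probs_integrable_continuous[OF \<eta> Y])
next
  assume "y \<in> Y"
  then have "continuous_on (X i) (\<lambda>x. exp (logG i f g (x, y)))"
    by (intro continuous_on_compose2[OF continuous_exp_logG[OF assms]]) (auto intro!: continuous_intros)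
  then show "integrable (\<nu> i) (\<lambda>x. exp (logG i f g (x, y)))"
    by (rule borel_probs_integrable_continuous[OF \<nu>[OF i] X[OF i]])
qed

lemma integral_exp_logG_fst:
  assumes "continuous_on (X i) f" "continuous_on Y g"
  shows "(\<integral>z. exp (logG i f g z) \<partial>(\<nu> i \<Otimes>\<^sub>M \<eta>)) = (\<integral>x. \<integral>y. exp (logG i f g (x, y)) \<partial>\<eta> \<partial>\<nu> i)"
proof -
  interpret pair_prob_space "\<nu> i" \<eta> by (rule pair_prob)
  show ?thesis using integral_fst'[OF integrable_exp_logG[OF assms]] by simp
qed

lemma integral_logG_x: "(\<integral>x. exp (logG i (f i) g (x, y)) \<partial>\<nu> i) = exp (g y / eps) * A_pot eps c \<nu> f i y"
proof -
  have "exp (logG i (f i) g (x, y)) = exp (g y / eps) * exp ((f i x - c i (x, y)) / eps)" for x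
    unfolding exp_add[symmetric] logG_def by (simp add: add_divide_distrib diff_divide_distrib)
  then show ?thesis unfolding A_pot_def by simp
qed

lemma integral_exp_logG_snd:
  assumes "continuous_on (X i) (f i)" "continuous_on Y g"
  shows "(\<integral>z. exp (logG i (f i) g z) \<partial>(\<nu> i \<Otimes>\<^sub>M \<eta>)) = (\<integral>y. exp (g y / eps) * A_pot eps c \<nu> f i y \<partial>\<eta>)"
proof -
  interpret pair_prob_space "\<nu> i" \<eta> by (rule pair_prob)
  show ?thesis
    using integral_snd[of "\<lambda>x y. exp (logG i (f i) g (x, y))"] integrable_exp_logG[OF assms]
    by (simp add: integral_logG_x split_beta')
qed

lemma continuous_marginal_x:
  assumes "continuous_on (X i) f" "continuous_on Y g"
  shows "continuous_on (X i) (\<lambda>x. \<integral>y. exp (logG i f g (x, y)) \<partial>\<eta>)"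
proof (rule continuous_on_integral_param[OF \<eta> Y X[OF i]])
  show "continuous_on (Y \<times> X i) (\<lambda>(y, x). exp (logG i f g (x, y)))"
    unfolding split_beta'
    by (rule continuous_on_compose2[OF continuous_exp_logG[OF assms], of "Y \<times> X i" "\<lambda>z. (snd z, fst z)"])
      (auto intro!: continuous_intros)
qed

lemma continuous_A_pot:
  assumes "continuous_on (X i) (f i)"
  shows "continuous_on Y (A_pot eps c \<nu> f i)"
proof -
  \<comment> \<open>\<open>A_pot\<close> is the integral over \<open>x\<close> of the Gibbs kernel
    whose second potential is zero.\<close>
  have "continuous_on (X i \<times> Y) (\<lambda>(x, y). exp (logG i (f i) (\<lambda>_. 0) (x, y)))"
    using continuous_exp_logG[OF assms, of "\<lambda>_. 0"] by (simp add: split_beta')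
  from continuous_on_integral_param[OF \<nu>[OF i] X[OF i] Y this]
  show ?thesis unfolding A_pot_def logG_def by simp
qed

lemma marginal_x_pos:
  assumes "continuous_on (X i) f" "continuous_on Y g" "x \<in> X i"
  shows "(\<integral>y. exp (logG i f g (x, y)) \<partial>\<eta>) > 0"
  using prob_integral_exp_pos[OF \<eta>.prob_space_axioms integrable_exp_logG_slice(1)[OF assms]] .

lemma A_pot_pos:
  assumes "continuous_on (X i) (f i)" "y \<in> Y"
  shows "A_pot eps c \<nu> f i y > 0"
  using prob_integral_exp_pos[OF borel_probsD(1)[OF \<nu>[OF i]]
      integrable_exp_logG_slice(2)[OF assms(1) continuous_on_const[of Y 0] assms(2)]]
  by (simp add: A_pot_def logG_def)

end

lemma dual_functional_logG:
  "dual_functional p eps lam c \<nu> \<eta> \<phi> \<psi> =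
    (\<Sum>i=1..p. lam i * ((\<integral>x. \<phi> i x \<partial>\<nu> i) - eps * (\<integral>z. exp (logG i (\<phi> i) (\<psi> i) z) \<partial>(\<nu> i \<Otimes>\<^sub>M \<eta>))))"
  unfolding dual_functional_def logG_def by (simp add: split_beta')

end

subsection \<open>Optimality conditions for the dual problem\<close>

locale entropic_barycenter_dual = entropic_barycenter +
  fixes \<phi> :: "nat \<Rightarrow> 'a \<Rightarrow> real" and \<psi> :: "nat \<Rightarrow> 'b \<Rightarrow> real"
  assumes adm: "(\<phi>, \<psi>) \<in> dual_admissible p X Y lam"
    and maxi: "\<And>\<phi>' \<psi>'. (\<phi>', \<psi>') \<in> dual_admissible p X Y lam \<Longrightarrow>
           dual_functional p eps lam c \<nu> \<eta> \<phi>' \<psi>' \<le> dual_functional p eps lam c \<nu> \<eta> \<phi> \<psi>"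
    and spt_\<eta>: "spt \<eta> = Y"
begin

abbreviation A :: "nat \<Rightarrow> 'b \<Rightarrow> real" where "A \<equiv> A_pot eps c \<nu> \<phi>"

abbreviation g :: "nat \<Rightarrow> 'a \<times> 'b \<Rightarrow> real" where "g i \<equiv> logG i (\<phi> i) (\<psi> i)"

text \<open>The logarithm of the weighted geometric mean of the \<open>A j\<close>, that is, of the
  claimed barycenter density.\<close>

definition lnB :: "'b \<Rightarrow> real" where "lnB y = (\<Sum>j=1..p. lam j * ln (A j y))"

lemma \<phi>: "i \<in> {1..p} \<Longrightarrow> continuous_on (X i) (\<phi> i)"
  and \<psi>: "i \<in> {1..p} \<Longrightarrow> continuous_on Y (\<psi> i)"
  and sum_\<psi>: "y \<in> Y \<Longrightarrow> (\<Sum>i=1..p. lam i * \<psi> i y) = 0"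
  using adm by (auto simp: dual_admissible_def)

lemma continuous_lnA: "i \<in> {1..p} \<Longrightarrow> continuous_on Y (\<lambda>y. ln (A i y))"
  using continuous_A_pot[where f=\<phi>, OF _ \<phi>] A_pot_pos[where f=\<phi>, OF _ \<phi>] by (force intro!: continuous_on_ln)

lemma continuous_lnB: "continuous_on Y lnB"
  unfolding lnB_def by (intro continuous_intros continuous_lnA) auto

text \<open>
  Replacing \<open>\<phi>\<^sub>i\<close> by \<open>\<phi>\<^sub>i - \<epsilon> ln G\<close>, with \<open>G\<close> the first marginal density, changes the dual functional
  by \<open>\<lambda>\<^sub>i \<epsilon> \<integral> (G - 1 - ln G) d\<nu>\<^sub>i \<ge> 0\<close>.
\<close>

lemma first_marginal_eq_1:
  assumes i: "i \<in> {1..p}"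
  shows "AE x in \<nu> i. (\<integral>y. exp (g i (x, y)) \<partial>\<eta>) = 1"
proof -
  interpret N: prob_space "\<nu> i" using borel_probsD(1)[OF \<nu>[OF i]] .
  have sp: "space (\<nu> i) = X i" using borel_probsD(3)[OF \<nu>[OF i]] .
  define G where "G = (\<lambda>x. \<integral>y. exp (g i (x, y)) \<partial>\<eta>)"
  have G: "continuous_on (X i) G"
    unfolding G_def using continuous_marginal_x[OF i \<phi>[OF i] \<psi>[OF i]] .
  have pos: "G x > 0" if "x \<in> X i" for x
    unfolding G_def using marginal_x_pos[OF i \<phi>[OF i] \<psi>[OF i] that] .
  have lnG: "continuous_on (X i) (\<lambda>x. ln (G x))" using G pos by (force intro!: continuous_on_ln)
  define f where "f = (\<lambda>x. \<phi> i x - eps * ln (G x))"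
  have f: "continuous_on (X i) f" unfolding f_def by (intro continuous_intros \<phi> i lnG)
  define \<phi>' where "\<phi>' = \<phi>(i := f)"
  have adm': "(\<phi>', \<psi>) \<in> dual_admissible p X Y lam"
    using adm f by (auto simp: dual_admissible_def \<phi>'_def)
  \<comment> \<open>The bracket of index \<open>j\<close> in the dual functional. Only the bracket
    of index \<open>i\<close> sees the change of potential, so the comparison reduces to it.\<close>
  define T where "T = (\<lambda>\<phi> j. (\<integral>x. \<phi> j x \<partial>\<nu> j) - eps * (\<integral>z. exp (logG j (\<phi> j) (\<psi> j) z) \<partial>(\<nu> j \<Otimes>\<^sub>M \<eta>)))"
  have "(\<Sum>j=1..p. lam j * T \<phi>' j) \<le> (\<Sum>j=1..p. lam j * T \<phi> j)"
    using maxi[OF adm'] unfolding dual_functional_logG T_def .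
  moreover have "(\<Sum>j\<in>{1..p} - {i}. lam j * T \<phi>' j) = (\<Sum>j\<in>{1..p} - {i}. lam j * T \<phi> j)"
    by (intro sum.cong) (auto simp: T_def \<phi>'_def)
  ultimately have "lam i * T \<phi>' i \<le> lam i * T \<phi> i"
    unfolding sum.remove[OF finite_atLeastAtMost i] by linarith
  then have "T \<phi>' i \<le> T \<phi> i" using lam[OF i] by simp
  moreover have "T \<phi> i = (\<integral>x. \<phi> i x \<partial>\<nu> i) - eps * (\<integral>x. G x \<partial>\<nu> i)"
    unfolding T_def G_def integral_exp_logG_fst[OF i \<phi>[OF i] \<psi>[OF i]] ..
  moreover have "T \<phi>' i = (\<integral>x. \<phi> i x \<partial>\<nu> i) - eps * (\<integral>x. ln (G x) \<partial>\<nu> i) - eps"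
  proof -
    \<comment> \<open>Subtracting \<open>eps * ln (G x)\<close> divides the kernel by
      \<open>G x\<close>, which normalizes its integral over \<open>y\<close>.\<close>
    have "(\<integral>y. exp (logG i f (\<psi> i) (x, y)) \<partial>\<eta>) = 1" if x: "x \<in> X i" for x
    proof -
      have "exp (logG i f (\<psi> i) (x, y)) = exp (g i (x, y)) / G x" for y
      proof -
        have "logG i f (\<psi> i) (x, y) = g i (x, y) - ln (G x)"
          using eps by (simp add: logG_def f_def field_simps)
        then show ?thesis using pos[OF x] by (simp add: exp_diff)
      qed
      then show ?thesis using pos[OF x] by (simp add: G_def)
    qed
    then have "(\<integral>x. \<integral>y. exp (logG i f (\<psi> i) (x, y)) \<partial>\<eta> \<partial>\<nu> i) = (\<integral>x. 1 \<partial>\<nu> i)"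
      using sp by (intro Bochner_Integration.integral_cong) auto
    then have "(\<integral>z. exp (logG i f (\<psi> i) z) \<partial>(\<nu> i \<Otimes>\<^sub>M \<eta>)) = 1"
      unfolding integral_exp_logG_fst[OF i f \<psi>[OF i]] by (simp add: N.prob_space)
    moreover have "integrable (\<nu> i) (\<phi> i)" "integrable (\<nu> i) (\<lambda>x. ln (G x))"
      using borel_probs_integrable_continuous[OF \<nu>[OF i] X[OF i]] \<phi>[OF i] lnG by auto
    ultimately show ?thesis by (simp add: T_def \<phi>'_def f_def)
  qed
  ultimately have "eps * ((\<integral>x. G x \<partial>\<nu> i) - 1 - (\<integral>x. ln (G x) \<partial>\<nu> i)) \<le> 0"
    by (simp add: algebra_simps)
  then have le: "(\<integral>x. G x \<partial>\<nu> i) - 1 - (\<integral>x. ln (G x) \<partial>\<nu> i) \<le> 0"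
    using eps by (simp add: mult_le_0_iff)
  have I: "integrable (\<nu> i) G" "integrable (\<nu> i) (\<lambda>x. ln (G x))"
    using borel_probs_integrable_continuous[OF \<nu>[OF i] X[OF i]] G lnG by auto
  then have int: "integrable (\<nu> i) (\<lambda>x. G x - 1 - ln (G x))" by simp
  \<comment> \<open>From \<open>ln G \<le> G - 1\<close>, where equality holds only at
    \<open>G = 1\<close>; a nonpositive integral therefore forces \<open>G = 1\<close> almost
    everywhere.\<close>
  have nn: "AE x in \<nu> i. 0 \<le> G x - 1 - ln (G x)"
  proof (rule AE_I2)
    fix x assume "x \<in> space (\<nu> i)"
    then show "0 \<le> G x - 1 - ln (G x)" using ln_le_minus_one[OF pos, of x] sp by simp
  qed
  have "(\<integral>x. G x - 1 - ln (G x) \<partial>\<nu> i) \<le> 0" using le I by (simp add: N.prob_space)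
  then have "(\<integral>x. G x - 1 - ln (G x) \<partial>\<nu> i) = 0" using integral_nonneg_AE[OF nn] by linarith
  then have "AE x in \<nu> i. G x - 1 - ln (G x) = 0" unfolding integral_nonneg_eq_0_iff_AE[OF int nn] .
  with AE_space show ?thesis
  proof eventually_elim
    case (elim x)
    then have "G x = 1" using ln_eq_minus_one[OF pos, of x] sp by simp
    then show ?case by (simp add: G_def)
  qed
qed

text \<open>
  Replacing \<open>\<psi>\<close> by the claimed potentials changes the dual functional by
  \<open>\<epsilon> \<integral> B \<Sum>\<^sub>i \<lambda>\<^sub>i (exp u\<^sub>i - 1 - u\<^sub>i) d\<eta>\<close> with \<open>B = \<Prod>\<^sub>j A\<^sub>j powr \<lambda>\<^sub>j\<close>,
  \<open>u\<^sub>i = \<psi>\<^sub>i/\<epsilon> + ln A\<^sub>i - ln B\<close> and \<open>\<Sum>\<^sub>i \<lambda>\<^sub>i u\<^sub>i = 0\<close>.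
\<close>

lemma potential_eq:
  assumes i: "i \<in> {1..p}" and y: "y \<in> Y"
  shows "\<psi> i y = eps * (lnB y - ln (A i y))"
proof -
  define \<psi>' where "\<psi>' = (\<lambda>i y. eps * (lnB y - ln (A i y)))"
  have c\<psi>': "continuous_on Y (\<psi>' i)" if "i \<in> {1..p}" for i
    unfolding \<psi>'_def by (intro continuous_intros continuous_lnB continuous_lnA that)
  \<comment> \<open>Since the weights sum to 1, averaging \<open>lnB\<close> returns
    \<open>lnB\<close>, which the average of the \<open>ln (A i y)\<close> cancels: the claimed
    potentials satisfy the dual constraint.\<close>
  have "(\<Sum>i=1..p. lam i * \<psi>' i y) = 0" for y
  proof -
    have "(\<Sum>i=1..p. lam i * \<psi>' i y) = eps * ((\<Sum>i=1..p. lam i) * lnB y - (\<Sum>i=1..p. lam i * ln (A i y)))"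
      by (simp add: \<psi>'_def sum_distrib_left sum_distrib_right sum_subtractf[symmetric] algebra_simps)
    then show ?thesis unfolding sum_lam lnB_def by simp
  qed
  then have "(\<phi>, \<psi>') \<in> dual_admissible p X Y lam"
    using c\<psi>' \<phi> by (auto simp: dual_admissible_def)
  note mx = maxi[OF this]
  \<comment> \<open>The second marginal density of the kernel. With \<open>\<phi>\<close> fixed, the
    exponential part of the dual functional is an integral of these over \<open>\<eta>\<close>
    alone.\<close>
  define F where "F = (\<lambda>\<psi> i y. exp (\<psi> i y / eps) * A i y)"
  have cF: "continuous_on Y (F \<psi>'' i)" if "i \<in> {1..p}" "continuous_on Y (\<psi>'' i)" for \<psi>'' i
    unfolding F_def using eps continuous_A_pot[where f=\<phi>, OF that(1) \<phi>[OF that(1)]] that(2)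
    by (auto intro!: continuous_intros)
  have intF: "integrable \<eta> (F \<psi>'' i)" if "i \<in> {1..p}" "continuous_on Y (\<psi>'' i)" for \<psi>'' i
    using borel_probs_integrable_continuous[OF \<eta> Y cF[of i \<psi>'', OF that]] .
  have dual: "dual_functional p eps lam c \<nu> \<eta> \<phi> \<psi>''
      = (\<Sum>i=1..p. lam i * (\<integral>x. \<phi> i x \<partial>\<nu> i)) - eps * (\<integral>y. (\<Sum>i=1..p. lam i * F \<psi>'' i y) \<partial>\<eta>)"
    if "\<And>i. i \<in> {1..p} \<Longrightarrow> continuous_on Y (\<psi>'' i)" for \<psi>''
  proof -
    have "(\<integral>y. (\<Sum>i=1..p. lam i * F \<psi>'' i y) \<partial>\<eta>) = (\<Sum>i=1..p. lam i * (\<integral>y. F \<psi>'' i y \<partial>\<eta>))"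
      using intF that by (subst Bochner_Integration.integral_sum) auto
    also have "\<dots> = (\<Sum>i=1..p. lam i * (\<integral>z. exp (logG i (\<phi> i) (\<psi>'' i) z) \<partial>(\<nu> i \<Otimes>\<^sub>M \<eta>)))"
      unfolding F_def using integral_exp_logG_snd[where f=\<phi>, OF _ \<phi>] that by (intro sum.cong) auto
    finally show ?thesis
      unfolding dual_functional_logG
      by (simp add: sum_distrib_left sum_subtractf algebra_simps)
  qed
  define S where "S = (\<lambda>\<psi> y. \<Sum>i=1..p. lam i * F \<psi> i y)"
  have cS: "continuous_on Y (S \<psi>)" "continuous_on Y (S \<psi>')"
    unfolding S_def using cF \<psi> c\<psi>' by (auto intro!: continuous_intros)
  then have iS: "integrable \<eta> (S \<psi>)" "integrable \<eta> (S \<psi>')"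
    using borel_probs_integrable_continuous[OF \<eta> Y] by auto
  have "eps * integral\<^sup>L \<eta> (S \<psi>) \<le> eps * integral\<^sup>L \<eta> (S \<psi>')"
    using mx unfolding S_def by (simp only: dual[of \<psi>] dual[of \<psi>'] \<psi> c\<psi>')
  then have "(\<integral>y. S \<psi> y - S \<psi>' y \<partial>\<eta>) \<le> 0" using eps iS by simp
  \<comment> \<open>The deviation \<open>(\<psi> i y - \<psi>' i y) / eps\<close> from the claimed
    potential.\<close>
  moreover define u where "u = (\<lambda>i y. \<psi> i y / eps + ln (A i y) - lnB y)"
  have F\<psi>: "F \<psi> i y = exp (lnB y) * exp (u i y)" and F\<psi>': "F \<psi>' i y = exp (lnB y)"
    if "i \<in> {1..p}" "y \<in> Y" for i y
    using A_pot_pos[where f=\<phi>, OF that(1) \<phi>[OF that(1)] that(2)] eps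
    by (simp_all add: F_def u_def \<psi>'_def exp_add exp_diff)
  have sum_u: "(\<Sum>i=1..p. lam i * u i y) = 0" if "y \<in> Y" for y
  proof -
    have "(\<Sum>i=1..p. lam i * u i y)
      = (\<Sum>i=1..p. lam i * \<psi> i y) / eps + (\<Sum>i=1..p. lam i * ln (A i y)) - (\<Sum>i=1..p. lam i) * lnB y"
      by (simp add: u_def sum_divide_distrib sum_distrib_right sum.distrib sum_subtractf algebra_simps)
    then show ?thesis unfolding sum_lam sum_\<psi>[OF that] lnB_def by simp
  qed
  have S: "S \<psi> y - S \<psi>' y = exp (lnB y) * (\<Sum>i=1..p. lam i * (exp (u i y) - 1 - u i y))" if "y \<in> Y" for y
  proof -
    have "S \<psi> y - S \<psi>' y = exp (lnB y) * (\<Sum>i=1..p. lam i * (exp (u i y) - 1))"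
      unfolding S_def sum_subtractf[symmetric] sum_distrib_left
      using F\<psi> F\<psi>' that by (intro sum.cong) (auto simp: algebra_simps)
    \<comment> \<open>Inserting the zero sum of the \<open>lam i * u i y\<close> makes every summand
      nonnegative.\<close>
    also have "(\<Sum>i=1..p. lam i * (exp (u i y) - 1)) = (\<Sum>i=1..p. lam i * (exp (u i y) - 1 - u i y))"
      using sum_u[OF that] by (simp add: right_diff_distrib sum_subtractf)
    finally show ?thesis .
  qed
  have t: "0 \<le> lam i * (exp (u i y) - 1 - u i y)" if "i \<in> {1..p}" for i y
  proof -
    have "0 \<le> exp (u i y) - 1 - u i y" using exp_ge_add_one_self[of "u i y"] by linarith
    then show ?thesis using lam[OF that] by simp
  qed
  have nn: "0 \<le> S \<psi> y - S \<psi>' y" if "y \<in> Y" for y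
    unfolding S[OF that] by (rule mult_nonneg_nonneg[OF exp_ge_zero sum_nonneg]) (rule t)
  \<comment> \<open>Continuity and full support of \<open>\<eta>\<close> give the equality at the
    given point \<open>y\<close> itself.\<close>
  have "S \<psi> y - S \<psi>' y = 0"
    by (rule integral_eq_0_full_spt[OF \<eta> spt_\<eta> Y _ nn \<open>(\<integral>y. S \<psi> y - S \<psi>' y \<partial>\<eta>) \<le> 0\<close> y])
      (intro continuous_intros cS)
  then have "(\<Sum>i=1..p. lam i * (exp (u i y) - 1 - u i y)) = 0" unfolding S[OF y] by simp
  then have "lam i * (exp (u i y) - 1 - u i y) = 0"
    using sum_nonneg_eq_0_iff[of "{1..p}" "\<lambda>i. lam i * (exp (u i y) - 1 - u i y)"] t i by simp
  then have "u i y = 0" using lam[OF i] exp_ge_add_one_self_eq_iff by simp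
  then show ?thesis using eps by (simp add: u_def field_simps)
qed

text \<open>By the potential formula \<open>exp (\<psi> i y / eps)\<close> is
  \<open>exp (lnB y) / A i y\<close>, so \<open>A i y\<close> cancels. The result does not depend on
  \<open>i\<close>, hence the plans share a second marginal.\<close>

lemma marginal_y: "i \<in> {1..p} \<Longrightarrow> y \<in> Y \<Longrightarrow> (\<integral>x. exp (g i (x, y)) \<partial>\<nu> i) = exp (lnB y)"
  using A_pot_pos[where f=\<phi>, OF _ \<phi>, of i y] eps
  by (simp add: integral_logG_x potential_eq exp_diff)

section \<open>The Gibbs plans and the candidate barycenter\<close>

definition bary :: "'b measure" where "bary = density \<eta> (\<lambda>y. ennreal (exp (lnB y)))"

definition plan :: "nat \<Rightarrow> ('a \<times> 'b) measure" where
  "plan i = density (\<nu> i \<Otimes>\<^sub>M \<eta>) (\<lambda>z. ennreal (exp (g i z)))"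

lemma plan_measurable:
  assumes i: "i \<in> {1..p}"
  shows "(\<lambda>z. ennreal (exp (g i z))) \<in> borel_measurable (\<nu> i \<Otimes>\<^sub>M \<eta>)"
  using borel_measurable_integrable[OF integrable_exp_logG[OF i \<phi>[OF i] \<psi>[OF i]]] by simp

lemma distr_plan:
  assumes i: "i \<in> {1..p}"
  shows "distr (plan i) (\<nu> i) fst = \<nu> i" and "distr (plan i) \<eta> snd = bary"
proof -
  interpret pair_prob_space "\<nu> i" \<eta> using pair_prob[OF i] .
  have sp: "space (\<nu> i) = X i" "space \<eta> = Y" using borel_probsD(3) \<nu>[OF i] \<eta> by auto
  note m[measurable] = plan_measurable[OF i]
  have "distr (plan i) (\<nu> i) fst = density (\<nu> i) (\<lambda>x. \<integral>\<^sup>+y. ennreal (exp (g i (x, y))) \<partial>\<eta>)"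
    unfolding plan_def by (intro distr_density_pair_fst m) unfold_locales
  also have "\<dots> = density (\<nu> i) (\<lambda>x. 1)"
  proof (rule density_cong)
    show "(\<lambda>x. \<integral>\<^sup>+y. ennreal (exp (g i (x, y))) \<partial>\<eta>) \<in> borel_measurable (\<nu> i)"
      by measurable
    show "AE x in \<nu> i. (\<integral>\<^sup>+y. ennreal (exp (g i (x, y))) \<partial>\<eta>) = 1"
      using first_marginal_eq_1[OF i] AE_space
    proof eventually_elim
      case (elim x)
      then show ?case
        using nn_integral_eq_integral[OF integrable_exp_logG_slice(1)[OF i \<phi>[OF i] \<psi>[OF i], of x]] sp
        by simp
    qed
  qed simp
  finally show "distr (plan i) (\<nu> i) fst = \<nu> i" by (simp add: density_1)
  have "distr (plan i) \<eta> snd = density \<eta> (\<lambda>y. \<integral>\<^sup>+x. ennreal (exp (g i (x, y))) \<partial>\<nu> i)"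
    unfolding plan_def by (intro distr_density_pair_snd m) unfold_locales
  also have "\<dots> = bary"
    unfolding bary_def
  proof (rule density_cong)
    show "(\<lambda>y. \<integral>\<^sup>+x. ennreal (exp (g i (x, y))) \<partial>\<nu> i) \<in> borel_measurable \<eta>" by measurable
    show "(\<lambda>y. ennreal (exp (lnB y))) \<in> borel_measurable \<eta>"
      using borel_probs_measurable_continuous[OF \<eta> continuous_lnB] by simp
    show "AE y in \<eta>. (\<integral>\<^sup>+x. ennreal (exp (g i (x, y))) \<partial>\<nu> i) = ennreal (exp (lnB y))"
    proof (rule AE_I2)
      fix y assume "y \<in> space \<eta>"
      then have y: "y \<in> Y" using sp by simp
      show "(\<integral>\<^sup>+x. ennreal (exp (g i (x, y))) \<partial>\<nu> i) = ennreal (exp (lnB y))"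
        using nn_integral_eq_integral[OF integrable_exp_logG_slice(2)[OF i \<phi>[OF i] \<psi>[OF i] y]]
          marginal_y[OF i y] by simp
    qed
  qed
  finally show "distr (plan i) \<eta> snd = bary" .
qed

subsection \<open>Optimality of the Gibbs plans\<close>

lemma integral_exp_g:
  assumes i: "i \<in> {1..p}"
  shows "(\<integral>z. exp (g i z) \<partial>(\<nu> i \<Otimes>\<^sub>M \<eta>)) = 1"
proof -
  interpret N: prob_space "\<nu> i" using borel_probsD(1)[OF \<nu>[OF i]] .
  have cont: "continuous_on (X i) (\<lambda>x. \<integral>y. exp (g i (x, y)) \<partial>\<eta>)"
    using continuous_marginal_x[OF i \<phi>[OF i] \<psi>[OF i]] .
  have "(\<integral>x. \<integral>y. exp (g i (x, y)) \<partial>\<eta> \<partial>\<nu> i) = (\<integral>x. 1 \<partial>\<nu> i)"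
    using borel_probs_measurable_continuous[OF \<nu>[OF i] cont] first_marginal_eq_1[OF i]
    by (intro integral_cong_AE) auto
  then show ?thesis
    unfolding integral_exp_logG_fst[OF i \<phi>[OF i] \<psi>[OF i]] by (simp add: N.prob_space)
qed

lemma plan_borel_probs:
  assumes i: "i \<in> {1..p}"
  shows "plan i \<in> borel_probs (X i \<times> Y)"
proof -
  have "emeasure (plan i) (space (plan i)) = (\<integral>\<^sup>+z. ennreal (exp (g i z)) \<partial>(\<nu> i \<Otimes>\<^sub>M \<eta>))"
    unfolding plan_def using plan_measurable[OF i] by (simp add: emeasure_density cong: nn_integral_cong)
  also have "\<dots> = 1"
    using nn_integral_eq_integral[OF integrable_exp_logG[OF i \<phi>[OF i] \<psi>[OF i]]] integral_exp_g[OF i]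
    by simp
  finally have "prob_space (plan i)" by (rule prob_spaceI)
  moreover have "sets (plan i) = sets (\<nu> i \<Otimes>\<^sub>M \<eta>)" by (simp add: plan_def)
  ultimately show ?thesis
    using borel_probsD(2)[OF \<xi>_borel_probs[OF i]] by (simp add: borel_probs_def)
qed

text \<open>The unit mass of \<open>bary\<close> is inherited from a plan, of which it is an image;
  the index supplies such a plan.\<close>

lemma bary_borel_probs:
  assumes i: "i \<in> {1..p}"
  shows "bary \<in> borel_probs Y"
proof -
  interpret P: prob_space "plan i" using borel_probsD(1)[OF plan_borel_probs[OF i]] .
  have "snd \<in> measurable (plan i) \<eta>" by (simp add: plan_def)
  then have "prob_space bary" using P.prob_space_distr[of snd \<eta>] distr_plan(2)[OF i] by simp
  then show ?thesis using borel_probsD(2)[OF \<eta>] by (simp add: borel_probs_def bary_def)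
qed

lemma plan_feasible:
  assumes "p \<ge> 1"
  shows "primal_feasible p X Y \<nu> plan bary"
proof -
  \<comment> \<open>A push-forward uses its target only through the sigma-algebra, which
    \<open>bary\<close> shares with \<open>\<eta>\<close>.\<close>
  have "distr (plan i) bary snd = bary" if "i \<in> {1..p}" for i
    using distr_plan(2)[OF that] distr_cong[OF refl, of bary \<eta> "plan i" snd snd]
    by (simp add: bary_def)
  then show ?thesis
    using plan_borel_probs bary_borel_probs[of 1] distr_plan(1) assms
    by (auto simp: primal_feasible_def couplings_def)
qed

lemma coupling_sets:
  assumes i: "i \<in> {1..p}" and "\<gamma> \<in> couplings (X i) Y (\<nu> i) \<mu>"
  shows "prob_space \<gamma>" "sets \<gamma> = sets (\<nu> i \<Otimes>\<^sub>M \<eta>)"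
  using assms(2) borel_probsD(1,2)[of \<gamma> "X i \<times> Y"] borel_probsD(2)[OF \<xi>_borel_probs[OF i]]
  by (auto simp: couplings_def)

text \<open>The function \<open>c i + eps * g i\<close> separates into a function of
  \<open>x\<close> plus a function of \<open>y\<close>, so its integral depends on the coupling only
  through the marginals.\<close>

lemma coupling_integral:
  assumes i: "i \<in> {1..p}" and \<gamma>: "\<gamma> \<in> couplings (X i) Y (\<nu> i) \<mu>" and \<mu>: "\<mu> \<in> borel_probs Y"
  shows "integrable \<gamma> (g i)" and "integral\<^sup>L \<gamma> (c i) + eps * integral\<^sup>L \<gamma> (g i)
    = (\<integral>x. \<phi> i x \<partial>\<nu> i) + (\<integral>y. \<psi> i y \<partial>\<mu>)"
proof -
  have \<gamma>p: "\<gamma> \<in> borel_probs (X i \<times> Y)"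
    and d: "distr \<gamma> (\<nu> i) fst = \<nu> i" "distr \<gamma> \<mu> snd = \<mu>"
    using \<gamma> by (auto simp: couplings_def)
  have s: "sets \<gamma> = sets (\<nu> i \<Otimes>\<^sub>M \<eta>)" "sets \<mu> = sets \<eta>"
    using coupling_sets(2)[OF i \<gamma>] borel_probsD(2)[OF \<mu>] borel_probsD(2)[OF \<eta>] by auto
  have m: "fst \<in> measurable \<gamma> (\<nu> i)" "snd \<in> measurable \<gamma> \<mu>"
    using measurable_cong_sets[OF s(1) refl, of "\<nu> i"] measurable_cong_sets[OF s(1) s(2)] by simp_all
  note I = borel_probs_integrable_continuous[OF \<gamma>p compact_Times[OF X[OF i] Y]]
  show "integrable \<gamma> (g i)" using I[OF continuous_logG[OF i \<phi>[OF i] \<psi>[OF i]]] .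
  have f: "(\<integral>z. \<phi> i (fst z) \<partial>\<gamma>) = (\<integral>x. \<phi> i x \<partial>\<nu> i)"
    using integral_distr[OF m(1) borel_probs_measurable_continuous[OF \<nu>[OF i] \<phi>[OF i]]] d by simp
  have g: "(\<integral>z. \<psi> i (snd z) \<partial>\<gamma>) = (\<integral>y. \<psi> i y \<partial>\<mu>)"
    using integral_distr[OF m(2) borel_probs_measurable_continuous[OF \<mu> \<psi>[OF i]]] d by simp
  have "continuous_on (X i \<times> Y) (\<lambda>z. \<phi> i (fst z))"
    by (rule continuous_on_compose2[OF \<phi>[OF i]]) (auto intro!: continuous_intros)
  moreover have "continuous_on (X i \<times> Y) (\<lambda>z. \<psi> i (snd z))"
    by (rule continuous_on_compose2[OF \<psi>[OF i]]) (auto intro!: continuous_intros)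
  ultimately have "integrable \<gamma> (\<lambda>z. \<phi> i (fst z))" "integrable \<gamma> (\<lambda>z. \<psi> i (snd z))" "integrable \<gamma> (c i)"
    using I c[OF i] by blast+
  moreover have "eps * integral\<^sup>L \<gamma> (g i) = (\<integral>z. \<phi> i (fst z) + \<psi> i (snd z) - c i z \<partial>\<gamma>)"
    unfolding logG_def using eps by (simp add: split_beta')
  ultimately show "integral\<^sup>L \<gamma> (c i) + eps * integral\<^sup>L \<gamma> (g i)
    = (\<integral>x. \<phi> i x \<partial>\<nu> i) + (\<integral>y. \<psi> i y \<partial>\<mu>)"
    by (simp add: f g)
qed

text \<open>Integrating the dual constraint against \<open>\<mu>\<close> removes the
  \<open>\<psi>\<close> part, whatever the second marginal is.\<close>

lemma weighted_potential_sum: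
  assumes "\<mu> \<in> borel_probs Y"
  shows "(\<Sum>i=1..p. lam i * ((\<integral>x. \<phi> i x \<partial>\<nu> i) + (\<integral>y. \<psi> i y \<partial>\<mu>)))
    = (\<Sum>i=1..p. lam i * (\<integral>x. \<phi> i x \<partial>\<nu> i))"
proof -
  have "(\<Sum>i=1..p. lam i * (\<integral>y. \<psi> i y \<partial>\<mu>)) = (\<integral>y. (\<Sum>i=1..p. lam i * \<psi> i y) \<partial>\<mu>)"
    using borel_probs_integrable_continuous[OF assms Y \<psi>]
    by (subst Bochner_Integration.integral_sum) auto
  also have "\<dots> = (\<integral>y. 0 \<partial>\<mu>)"
    using sum_\<psi> borel_probsD(3)[OF assms] by (intro Bochner_Integration.integral_cong) auto
  finally show ?thesis by (simp add: distrib_left sum.distrib)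
qed

text \<open>
  By the Gibbs principle each term of the primal cost is at least \<open>\<lambda>\<^sub>i\<close> times
  \<open>\<integral> \<phi>\<^sub>i d\<nu>\<^sub>i + \<integral> \<psi>\<^sub>i d\<mu>\<close>, with equality only for the Gibbs plan. The \<open>\<psi>\<^sub>i\<close> parts cancel in the sum,
  so the lower bound does not depend on the competitor.
\<close>

lemma primal_optimal_eq_plan:
  assumes opt: "primal_optimal p eps X Y lam c \<nu> \<eta> \<gamma> \<mu>" and i: "i \<in> {1..p}"
  shows "\<gamma> i = plan i"
proof -
  define u where "u = (\<lambda>\<mu> i. lam i * ((\<integral>x. \<phi> i x \<partial>\<nu> i) + (\<integral>y. \<psi> i y \<partial>\<mu>)))"
  \<comment> \<open>The summand of index \<open>i\<close> in the primal cost; \<open>u\<close> is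
    the matching lower bound, attained by the Gibbs plan.\<close>
  define K where "K = (\<lambda>\<gamma> i. ereal (lam i) *
    (ereal (integral\<^sup>L (\<gamma> i) (c i)) + ereal eps * KL (\<gamma> i) (\<nu> i \<Otimes>\<^sub>M \<eta>)))"
  have "p \<ge> 1" using i by simp
  note pf = plan_feasible[OF this]
  have \<mu>: "\<mu> \<in> borel_probs Y" and \<gamma>: "\<And>i. i \<in> {1..p} \<Longrightarrow> \<gamma> i \<in> couplings (X i) Y (\<nu> i) \<mu>"
    using opt by (auto simp: primal_optimal_def primal_feasible_def)
  have b: "bary \<in> borel_probs Y" and pl: "\<And>i. i \<in> {1..p} \<Longrightarrow> plan i \<in> couplings (X i) Y (\<nu> i) bary"
    using pf by (auto simp: primal_feasible_def)
  have prob: "prob_space (\<nu> j \<Otimes>\<^sub>M \<eta>)" if "j \<in> {1..p}" for j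
    using borel_probsD(1)[OF \<xi>_borel_probs[OF that]] .
  have g_meas: "g j \<in> borel_measurable (\<nu> j \<Otimes>\<^sub>M \<eta>)" if j: "j \<in> {1..p}" for j
    using borel_probs_measurable_continuous[OF \<xi>_borel_probs[OF j] continuous_logG[OF j \<phi>[OF j] \<psi>[OF j]]] .
  have K_plan: "K plan j = ereal (u bary j)" if j: "j \<in> {1..p}" for j
  proof -
    have "KL (plan j) (\<nu> j \<Otimes>\<^sub>M \<eta>) = ereal (integral\<^sup>L (plan j) (g j))"
      using prob[OF j] g_meas[OF j] plan_def[of j] coupling_integral(1)[OF j pl[OF j] b]
      by (rule KL_density_exp)
    then show ?thesis
      using coupling_integral(2)[OF j pl[OF j] b] by (simp add: K_def u_def)
  qed
  note var = KL_variational[OF prob coupling_sets(1)[OF _ \<gamma>] coupling_sets(2)[OF _ \<gamma>] g_meas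
      coupling_integral(1)[OF _ \<gamma> \<mu>] integrable_exp_logG[OF _ \<phi> \<psi>] integral_exp_g]
  have K_ge: "ereal (u \<mu> j) \<le> K \<gamma> j" if j: "j \<in> {1..p}" for j
  proof (cases "KL (\<gamma> j) (\<nu> j \<Otimes>\<^sub>M \<eta>)")
    case (real r)
    then have "integral\<^sup>L (\<gamma> j) (g j) \<le> r" using var(1)[OF j j j j j j j j j j j j] by simp
    then have "integral\<^sup>L (\<gamma> j) (c j) + eps * integral\<^sup>L (\<gamma> j) (g j) \<le> integral\<^sup>L (\<gamma> j) (c j) + eps * r"
      using eps by simp
    then show ?thesis
      using lam[OF j] unfolding coupling_integral(2)[OF j \<gamma>[OF j] \<mu>] by (simp add: K_def u_def real)
  next
    \<comment> \<open>The positive factors \<open>lam j\<close> and \<open>eps\<close> keep the term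
      infinite. The value \<open>-\<infinity>\<close> is excluded below by the real lower bound on
      the entropy.\<close>
    case PInf
    then show ?thesis using lam[OF j] eps by (simp add: K_def)
  next
    case MInf
    then show ?thesis using var(1)[OF j j j j j j j j j j j j] by simp
  qed
  have "sum (K \<gamma>) {1..p} \<le> sum (K plan) {1..p}"
    using opt pf unfolding primal_optimal_def primal_cost_def K_def by blast
  also have "\<dots> = ereal (sum (u bary) {1..p})" using K_plan by simp
  \<comment> \<open>The marginals \<open>bary\<close> and \<open>\<mu>\<close> may still differ
    here, but their \<open>\<psi>\<close> parts have both dropped out, so the termwise bounds for
    \<open>\<gamma>\<close> are compared with their own sum.\<close>
  also have "\<dots> = ereal (sum (u \<mu>) {1..p})"
    unfolding u_def weighted_potential_sum[OF b] weighted_potential_sum[OF \<mu>] ..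
  finally have "K \<gamma> i = ereal (u \<mu> i)"
    using K_ge i by (intro sum_ereal_le_imp_eq[of "{1..p}"]) auto
  \<comment> \<open>Cancelling \<open>lam i\<close>, the cost integral and \<open>eps\<close> leaves
    the equality case of the Gibbs principle.\<close>
  then have "KL (\<gamma> i) (\<nu> i \<Otimes>\<^sub>M \<eta>) \<le> ereal (integral\<^sup>L (\<gamma> i) (g i))"
    using lam[OF i] eps unfolding u_def coupling_integral(2)[OF i \<gamma>[OF i] \<mu>, symmetric] K_def
    by (cases "KL (\<gamma> i) (\<nu> i \<Otimes>\<^sub>M \<eta>)") auto
  then show ?thesis
    unfolding plan_def by (rule var(2)[OF i i i i i i i i i i i i])
qed

section \<open>Identification of the barycenter and its density\<close>

lemma primal_optimal_eq_bary:
  assumes opt: "primal_optimal p eps X Y lam c \<nu> \<eta> \<gamma> \<mu>" and i: "i \<in> {1..p}"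
  shows "\<mu> = bary"
proof -
  have \<mu>: "\<mu> \<in> borel_probs Y" "\<gamma> i \<in> couplings (X i) Y (\<nu> i) \<mu>"
    using opt i by (auto simp: primal_optimal_def primal_feasible_def)
  have "\<mu> = distr (plan i) \<mu> snd"
    using \<mu>(2) primal_optimal_eq_plan[OF opt i] by (simp add: couplings_def)
  also have "\<dots> = distr (plan i) \<eta> snd"
    using borel_probsD(2)[OF \<mu>(1)] borel_probsD(2)[OF \<eta>] by (intro distr_cong) auto
  finally show ?thesis using distr_plan(2)[OF i] by simp
qed

lemma prod_A_powr: "y \<in> Y \<Longrightarrow> (\<Prod>j=1..p. A j y powr lam j) = exp (lnB y)"
  unfolding lnB_def exp_sum[OF finite_atLeastAtMost]
  using A_pot_pos[where f=\<phi>, OF _ \<phi>] by (intro prod.cong) (force simp: powr_def)+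

end

theorem theorem6p1:
  fixes p :: nat and eps :: real
    and X :: "nat \<Rightarrow> 'a::metric_space set" and Y :: "'b::metric_space set"
    and \<nu> :: "nat \<Rightarrow> 'a measure" and \<eta> :: "'b measure"
    and c :: "nat \<Rightarrow> 'a \<times> 'b \<Rightarrow> real" and lam :: "nat \<Rightarrow> real"
    and \<phi> :: "nat \<Rightarrow> 'a \<Rightarrow> real" and \<psi> :: "nat \<Rightarrow> 'b \<Rightarrow> real"
    and \<gamma> :: "nat \<Rightarrow> ('a \<times> 'b) measure" and \<nu>_eps :: "'b measure"
  assumes "p \<ge> 2" and "eps > 0"
    and "\<And>i. i \<in> {1..p} \<Longrightarrow> compact (X i)" and "compact Y"
    and "\<And>i. i \<in> {1..p} \<Longrightarrow> \<nu> i \<in> borel_probs (X i)" and "\<eta> \<in> borel_probs Y"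
    and "\<And>i. i \<in> {1..p} \<Longrightarrow> spt (\<nu> i) = X i" and "spt \<eta> = Y"
    and "\<And>i. i \<in> {1..p} \<Longrightarrow> continuous_on (X i \<times> Y) (c i)"
    and "\<And>i. i \<in> {1..p} \<Longrightarrow> lam i > 0" and "(\<Sum>i=1..p. lam i) = 1"
    and "(\<phi>, \<psi>) \<in> dual_admissible p X Y lam"
    and "\<And>\<phi>' \<psi>'. (\<phi>', \<psi>') \<in> dual_admissible p X Y lam \<Longrightarrow>
           dual_functional p eps lam c \<nu> \<eta> \<phi>' \<psi>' \<le> dual_functional p eps lam c \<nu> \<eta> \<phi> \<psi>"
    and "primal_optimal p eps X Y lam c \<nu> \<eta> \<gamma> \<nu>_eps"
  shows "(\<forall>i\<in>{1..p}.
            absolutely_continuous (\<nu> i \<Otimes>\<^sub>M \<eta>) (\<gamma> i) \<and>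
            (AE (x, y) in \<nu> i \<Otimes>\<^sub>M \<eta>. RN_deriv (\<nu> i \<Otimes>\<^sub>M \<eta>) (\<gamma> i) (x, y) =
               ennreal (exp ((\<phi> i x + \<psi> i y - c i (x, y)) / eps))) \<and>
            (AE x in \<nu> i. (\<integral>y. exp ((\<phi> i x + \<psi> i y - c i (x, y)) / eps) \<partial>\<eta>) = 1) \<and>
            (\<forall>y\<in>Y. \<psi> i y =
               eps * ((\<Sum>j=1..p. lam j * ln (A_pot eps c \<nu> \<phi> j y)) - ln (A_pot eps c \<nu> \<phi> i y))))
       \<and> absolutely_continuous \<eta> \<nu>_eps
       \<and> (AE y in \<eta>. RN_deriv \<eta> \<nu>_eps y = ennreal (\<Prod>j=1..p. A_pot eps c \<nu> \<phi> j y powr lam j))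
       \<and> continuous_on Y (\<lambda>y. \<Prod>j=1..p. A_pot eps c \<nu> \<phi> j y powr lam j)
       \<and> (\<forall>y\<in>Y. (\<Prod>j=1..p. A_pot eps c \<nu> \<phi> j y powr lam j) > 0)
       \<and> absolutely_continuous \<eta> \<nu>_eps \<and> absolutely_continuous \<nu>_eps \<eta>"
proof -
  interpret entropic_barycenter_dual p eps X Y \<nu> \<eta> c lam \<phi> \<psi>
    using assms by unfold_locales auto
  note opt = assms(14)
  have "1 \<in> {1..p}" using \<open>p \<ge> 2\<close> by simp
  note \<nu>_eps = primal_optimal_eq_bary[OF opt this]
  have plans: "absolutely_continuous (\<nu> i \<Otimes>\<^sub>M \<eta>) (\<gamma> i) \<and>
    (AE (x, y) in \<nu> i \<Otimes>\<^sub>M \<eta>. RN_deriv (\<nu> i \<Otimes>\<^sub>M \<eta>) (\<gamma> i) (x, y) =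
      ennreal (exp ((\<phi> i x + \<psi> i y - c i (x, y)) / eps)))" if i: "i \<in> {1..p}" for i
  proof
    interpret P: prob_space "\<nu> i \<Otimes>\<^sub>M \<eta>" using borel_probsD(1)[OF \<xi>_borel_probs[OF i]] .
    have \<gamma>: "\<gamma> i = density (\<nu> i \<Otimes>\<^sub>M \<eta>) (\<lambda>z. ennreal (exp (g i z)))"
      using primal_optimal_eq_plan[OF opt i] by (simp add: plan_def)
    show "absolutely_continuous (\<nu> i \<Otimes>\<^sub>M \<eta>) (\<gamma> i)"
      unfolding \<gamma> by (rule absolutely_continuousI_density[OF plan_measurable[OF i]])
    have "AE z in \<nu> i \<Otimes>\<^sub>M \<eta>. ennreal (exp (g i z)) = RN_deriv (\<nu> i \<Otimes>\<^sub>M \<eta>) (\<gamma> i) z"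
      by (rule P.RN_deriv_unique[OF plan_measurable[OF i] \<gamma>[symmetric]])
    then show "AE (x, y) in \<nu> i \<Otimes>\<^sub>M \<eta>. RN_deriv (\<nu> i \<Otimes>\<^sub>M \<eta>) (\<gamma> i) (x, y) =
      ennreal (exp ((\<phi> i x + \<psi> i y - c i (x, y)) / eps))"
      by eventually_elim (simp add: logG_def split_beta')
  qed
  have m: "(\<lambda>y. ennreal (exp (lnB y))) \<in> borel_measurable \<eta>"
    using borel_probs_measurable_continuous[OF \<eta> continuous_lnB] by simp
  have ac: "absolutely_continuous \<eta> \<nu>_eps"
    unfolding \<nu>_eps bary_def by (rule absolutely_continuousI_density[OF m])
  \<comment> \<open>An exponential density vanishes nowhere, so every null set of the barycenter is
    already a null set of \<open>\<eta>\<close>.\<close>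
  have ca: "absolutely_continuous \<nu>_eps \<eta>"
    unfolding \<nu>_eps bary_def absolutely_continuous_def
    using m by (auto simp: null_sets_density_iff AE_iff_null_sets)
  have "AE y in \<eta>. ennreal (exp (lnB y)) = RN_deriv \<eta> \<nu>_eps y"
    by (rule \<eta>.RN_deriv_unique[OF m]) (simp add: \<nu>_eps bary_def)
  with AE_space have RN: "AE y in \<eta>. RN_deriv \<eta> \<nu>_eps y = ennreal (\<Prod>j=1..p. A j y powr lam j)"
    by eventually_elim (use borel_probsD(3)[OF \<eta>] in \<open>simp only: prod_A_powr\<close>)
  have "continuous_on Y (\<lambda>y. exp (lnB y))" using continuous_lnB by (rule continuous_on_exp)
  then have cont: "continuous_on Y (\<lambda>y. \<Prod>j=1..p. A j y powr lam j)"
    by (rule continuous_on_eq) (rule prod_A_powr[symmetric])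
  have pos: "\<forall>y\<in>Y. (\<Prod>j=1..p. A j y powr lam j) > 0" using prod_A_powr exp_gt_zero by metis
  have pot: "(AE x in \<nu> i. (\<integral>y. exp ((\<phi> i x + \<psi> i y - c i (x, y)) / eps) \<partial>\<eta>) = 1) \<and>
    (\<forall>y\<in>Y. \<psi> i y = eps * ((\<Sum>j=1..p. lam j * ln (A j y)) - ln (A i y)))" if i: "i \<in> {1..p}" for i
    using first_marginal_eq_1[OF i] potential_eq[OF i] by (simp add: logG_def lnB_def)
  show ?thesis
    using plans pot ac RN cont pos ca by blast
qed

end
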